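(* Let $X$ be a real Banach space and $f:X\to\mathbb R$ a locally Lipschitz functional. Let $K$ be a compact metric space, $K^*$ a nonempty closed subset of $K$, and $p^*:K^*\to X$ a continuous map. Put $$\mathcal P=\{p\in C(K,X):\ p=p^*\text{ on }K^*\},\qquad c=\inf_{p\in\mathcal P}\max_{t\in K}f(p(t)).$$ Assume that $$c>\max_{t\in K^*}f(p^*(t)).$$ Then there exists a sequence $(x_n)$ in $X$ such that (i) $\lim_{n\to\infty}f(x_n)=c$; (ii) $\lim_{n\to\infty}\lambda(x_n)=0$.
   Context: $f$ is locally Lipschitz if every $x\in X$ has a neighbourhood $V$ and a constant $k>0$ with $|f(y)-f(z)|\le k\|y-z\|$ for $y,z\in V$. The generalized directional derivative is $f^0(x,v)=\limsup_{y\to x,\ \mu\searrow0}\frac{f(y+\mu v)-f(y)}{\mu}$. The Clarke generalized gradient is $\partial f(x)=\{x^*\in X^*:\ f^0(x,v)\ge\langle x^*,v\rangle\ \text{for all }v\in X\}$. Finally $\lambda(x)=\min_{x^*\in\partial f(x)}\|x^*\|$. *)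

theory Defs
  imports "HOL-Analysis.Analysis"
begin

definition locally_lipschitz :: "('a::real_normed_vector \<Rightarrow> real) \<Rightarrow> bool" where
  "locally_lipschitz f \<longleftrightarrow>
     (\<forall>x. \<exists>V k. open V \<and> x \<in> V \<and> k > 0 \<and> (\<forall>y\<in>V. \<forall>z\<in>V. \<bar>f y - f z\<bar> \<le> k * norm (y - z)))"

text \<open>
  The upper limit is taken in the extended reals, so that it exists for every \<open>f\<close>; it is finite
  when \<open>f\<close> is locally Lipschitz. The base point \<open>y\<close> ranges over full neighbourhoods of \<open>x\<close>,
  so \<open>y = x\<close> is allowed.
\<close>

definition clarke_derivative :: "('a::real_normed_vector \<Rightarrow> real) \<Rightarrow> 'a \<Rightarrow> 'a \<Rightarrow> ereal" where
  "clarke_derivative f x v =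
     Limsup (nhds x \<times>\<^sub>F at_right 0) (\<lambda>(y, \<mu>). ereal ((f (y + \<mu> *\<^sub>R v) - f y) / \<mu>))"

definition clarke_gradient :: "('a::real_normed_vector \<Rightarrow> real) \<Rightarrow> 'a \<Rightarrow> ('a \<Rightarrow>\<^sub>L real) set" where
  "clarke_gradient f x =
     {\<xi>. \<forall>v. clarke_derivative f x v \<ge> ereal (blinfun_apply \<xi> v)}"

text \<open>
  The next two definitions are a genuine minimum and maximum, with a meaningful value only if
  attained: the minimum is attained for locally Lipschitz \<open>f\<close>, the maximum for \<open>g\<close> continuous
  on a nonempty compact set \<open>S\<close>.
\<close>

definition min_norm_gradient :: "('a::real_normed_vector \<Rightarrow> real) \<Rightarrow> 'a \<Rightarrow> real" where
  "min_norm_gradient f x = (LEAST r. r \<in> norm ` clarke_gradient f x)"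

definition max_on :: "'k set \<Rightarrow> ('k \<Rightarrow> real) \<Rightarrow> real" where
  "max_on S g = (GREATEST m. m \<in> g ` S)"

text \<open>
  Elements of \<open>C(K,X)\<close> are represented by total functions continuous on \<open>K\<close>; their values
  outside \<open>K\<close> are irrelevant.
\<close>

definition extensions ::
  "'k::metric_space set \<Rightarrow> 'k set \<Rightarrow> ('k \<Rightarrow> 'a::real_normed_vector) \<Rightarrow> ('k \<Rightarrow> 'a) set" where
  "extensions K Ks ps = {p. continuous_on K p \<and> (\<forall>t\<in>Ks. p t = ps t)}"

definition minimax_level ::
  "('a::real_normed_vector \<Rightarrow> real) \<Rightarrow> 'k::metric_space set \<Rightarrow> 'k set \<Rightarrow> ('k \<Rightarrow> 'a) \<Rightarrow> real" where
  "minimax_level f K Ks ps = (INF p\<in>extensions K Ks ps. max_on K (\<lambda>t. f (p t)))"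

end

(*
  If f had only points with lambda > eps near the level c, every x with f x near c would have a
  unit direction v in which f decreases at rate eps / 2, uniformly for base points near x:
  otherwise f^0(x, v) >= - eps * norm v for all v, and Hahn-Banach gives an element of the
  Clarke gradient of norm at most eps. Ekeland's principle on the paths with the sup distance
  gives a path p of near-minimal maximum that no other path improves at rate eps / 4. Since
  c exceeds the maximum of f on the prescribed part ps of the path, the points where f o p is
  maximal stay away from Ks; blending the descent directions there by a partition of unity turns
  p into a path that contradicts this.
*)

theory Submission
  imports Defs
begin

text \<open>The rate is halved twice. A Clarke derivative of at most \<open>- e\<close> in a unit
  direction is weakened to \<open>- e / 2\<close>, because only a strict upper bound yields a whole
  ball of base points and steps. The blended field has weight at least 1/2 only outside a set on
  which f o p already stays below its maximum, so blending leaves \<open>e / 4\<close>, and the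
  variational principle is applied with exactly this rate. The path moves by at most the same
  positive \<open>\<mu>\<close> that measures the gain, so a non-strict comparison already gives the
  contradiction. Two quantities acquire their meaning only inside the proof.
  \<open>min_norm_gradient\<close> is a \<open>LEAST\<close>, so it can be estimated only once a
  gradient element of minimal norm is found. \<open>minimax_level\<close> is an infimum over a set
  that has to be shown nonempty, so \<open>ps\<close> must be extended continuously from
  \<open>Ks\<close> with values in X. Completeness of X serves there and in the variational
  principle.\<close>

section \<open>Sublinear functionals and linear functionals below them\<close>

definition sublinear :: "('a::real_vector \<Rightarrow> real) \<Rightarrow> bool" where
  "sublinear q \<longleftrightarrow> (\<forall>x y. q (x + y) \<le> q x + q y) \<and> (\<forall>t x. 0 < t \<longrightarrow> q (t *\<^sub>R x) \<le> t * q x) \<and> q 0 = 0"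

lemma sublinear_add: "sublinear q \<Longrightarrow> q (x + y) \<le> q x + q y"
  and sublinear_scale_le: "sublinear q \<Longrightarrow> 0 < t \<Longrightarrow> q (t *\<^sub>R x) \<le> t * q x"
  and sublinear_zero: "sublinear q \<Longrightarrow> q 0 = 0"
  by (auto simp: sublinear_def)

text \<open>Scaling back by \<open>inverse t\<close> turns the one-sided condition of the definition
  into an equality, so the infima constructed below have to verify only one direction.\<close>

lemma sublinear_scale:
  assumes "sublinear q" "0 \<le> t"
  shows "q (t *\<^sub>R x) = t * q x"
proof (cases "t = 0")
  case True
  then show ?thesis using assms by (simp add: sublinear_zero)
next
  case False
  then have t: "0 < t" using assms by simp
  have "q x \<le> inverse t * q (t *\<^sub>R x)"
    using sublinear_scale_le[OF assms(1), of "inverse t" "t *\<^sub>R x"] t by simp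
  then have "t * q x \<le> q (t *\<^sub>R x)"
    using t by (simp add: field_simps)
  then show ?thesis using sublinear_scale_le[OF assms(1) t, of x] by simp
qed

lemma sublinear_neg: "sublinear q \<Longrightarrow> - q (- x) \<le> q x"
  using sublinear_add[of q x "-x"] sublinear_zero[of q] by simp

text \<open>Every member satisfies \<open>- q (- v) \<le> p v\<close>, so the infimum is finite.
  Comparability enters in subadditivity: of two members chosen for the two summands, the smaller one
  bounds both.\<close>

lemma sublinear_INF_chain:
  assumes C: "C \<noteq> {}" "\<And>p. p \<in> C \<Longrightarrow> sublinear p \<and> p \<le> q"
    and ch: "\<And>p p'. p \<in> C \<Longrightarrow> p' \<in> C \<Longrightarrow> p \<le> p' \<or> p' \<le> p"
  shows "sublinear (\<lambda>v. INF p\<in>C. p v)" and "\<And>p. p \<in> C \<Longrightarrow> (\<lambda>v. INF p\<in>C. p v) \<le> p"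
proof -
  have bdd: "bdd_below ((\<lambda>p. p v) ` C)" for v
  proof (rule bdd_belowI2[where m = "- q (- v)"])
    fix p assume "p \<in> C"
    then show "- q (- v) \<le> p v"
      using C(2)[of p] sublinear_neg[of p v] le_funD[of p q "-v"] by force
  qed
  have low: "(INF p\<in>C. p v) \<le> p v" if "p \<in> C" for p v
    using bdd that by (rule cINF_lower)
  then show "\<And>p. p \<in> C \<Longrightarrow> (\<lambda>v. INF p\<in>C. p v) \<le> p" by (simp add: le_fun_def)
  show "sublinear (\<lambda>v. INF p\<in>C. p v)"
    unfolding sublinear_def
  proof (intro conjI allI impI)
    fix x y
    have *: "(INF p\<in>C. p (x + y)) \<le> p1 x + p2 y" if p: "p1 \<in> C" "p2 \<in> C" for p1 p2
      using ch[OF p]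
    proof
      assume le: "p1 \<le> p2"
      have "(INF p\<in>C. p (x + y)) \<le> p1 x + p1 y"
        using low[OF p(1), of "x + y"] C(2)[OF p(1)] sublinear_add[of p1 x y] by linarith
      then show ?thesis using le_funD[OF le, of y] by simp
    next
      assume le: "p2 \<le> p1"
      have "(INF p\<in>C. p (x + y)) \<le> p2 x + p2 y"
        using low[OF p(2), of "x + y"] C(2)[OF p(2)] sublinear_add[of p2 x y] by linarith
      then show ?thesis using le_funD[OF le, of x] by simp
    qed
    have "(INF p\<in>C. p (x + y)) - (INF p\<in>C. p x) \<le> (INF p\<in>C. p y)"
    proof (rule cINF_greatest[OF C(1)])
      fix p2 assume "p2 \<in> C"
      then have "(INF p\<in>C. p (x + y)) - p2 y \<le> (INF p\<in>C. p x)"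
        using * by (intro cINF_greatest[OF C(1)]) (simp add: algebra_simps)
      then show "(INF p\<in>C. p (x + y)) - (INF p\<in>C. p x) \<le> p2 y" by simp
    qed
    then show "(INF p\<in>C. p (x + y)) \<le> (INF p\<in>C. p x) + (INF p\<in>C. p y)" by simp
  next
    fix t :: real and x :: 'a assume t: "0 < t"
    have "(INF p\<in>C. p (t *\<^sub>R x)) / t \<le> (INF p\<in>C. p x)"
    proof (rule cINF_greatest[OF C(1)])
      fix p assume p: "p \<in> C"
      have "(INF p\<in>C. p (t *\<^sub>R x)) \<le> t * p x"
        using low[OF p, of "t *\<^sub>R x"] C(2)[OF p] sublinear_scale_le[of p t x] t by linarith
      then show "(INF p\<in>C. p (t *\<^sub>R x)) / t \<le> p x" using t by (simp add: field_simps)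
    qed
    then show "(INF p\<in>C. p (t *\<^sub>R x)) \<le> t * (INF p\<in>C. p x)" using t by (simp add: field_simps)
  next
    have "(\<lambda>p. p 0) ` C = {0}"
      using C sublinear_zero by (auto simp: image_iff)
    then show "(INF p\<in>C. p 0) = 0" by simp
  qed
qed

text \<open>Zorn's lemma for the reversed pointwise order: a nonempty chain is bounded by its
  infimum, the empty chain by \<open>q\<close> itself.\<close>

lemma minimal_sublinear_exists:
  assumes "sublinear q"
  obtains p where "sublinear p" "p \<le> q" "\<And>p'. sublinear p' \<Longrightarrow> p' \<le> p \<Longrightarrow> p' = p"
proof -
  define D where "D = {p. sublinear p \<and> p \<le> q}"
  have qD: "q \<in> D" using assms by (simp add: D_def)
  have "\<exists>m\<in>D. \<forall>a\<in>D. a \<le> m \<longrightarrow> a = m"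
  proof (rule predicate_Zorn[where P = "\<lambda>a b. b \<le> a"])
    show "partial_order_on D (relation_of (\<lambda>a b. b \<le> a) D)"
      by (rule partial_order_on_relation_ofI) auto
  next
    fix C assume C: "C \<in> Chains (relation_of (\<lambda>a b. b \<le> a) D)"
    have CD: "C \<subseteq> D" and ch: "\<And>a b. a \<in> C \<Longrightarrow> b \<in> C \<Longrightarrow> a \<le> b \<or> b \<le> a"
      using C unfolding Chains_def relation_of_def by blast+
    show "\<exists>u\<in>D. \<forall>a\<in>C. u \<le> a"
    proof (cases "C = {}")
      case True
      then show ?thesis using qD by blast
    next
      case False
      let ?u = "\<lambda>v. INF p\<in>C. p v"
      have CD': "\<And>p. p \<in> C \<Longrightarrow> sublinear p \<and> p \<le> q" using CD by (auto simp: D_def)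
      have u: "sublinear ?u" "\<And>p. p \<in> C \<Longrightarrow> ?u \<le> p"
        using sublinear_INF_chain[OF False CD' ch] by blast+
      obtain p where "p \<in> C" using False by blast
      then have "?u \<le> q" using u(2) CD' order_trans by blast
      then show ?thesis using u by (intro bexI[of _ ?u]) (auto simp: D_def)
    qed
  qed
  then obtain m where m: "m \<in> D" "\<And>a. a \<in> D \<Longrightarrow> a \<le> m \<Longrightarrow> a = m" by blast
  show thesis
  proof (rule that[of m])
    show "sublinear m" "m \<le> q" using m(1) by (auto simp: D_def)
    fix p' assume "sublinear p'" "p' \<le> m"
    then show "p' = m" using m(1) by (intro m(2)) (auto simp: D_def intro: order_trans)
  qed
qed

text \<open>Minimality is tested on \<open>g\<close>, the infimum of
  \<open>p (v + t y) - t p y\<close> over t \<ge> 0. It is sublinear and at most \<open>p\<close>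
  (take t = 0), hence equal to \<open>p\<close>; taking t = 1 as competitor in \<open>g x\<close>
  gives the claim.\<close>

lemma minimal_sublinear_superadditive:
  fixes p :: "'a::real_vector \<Rightarrow> real"
  assumes p: "sublinear p" and min: "\<And>p'. sublinear p' \<Longrightarrow> p' \<le> p \<Longrightarrow> p' = p"
  shows "p x + p y \<le> p (x + y)"
proof -
  define g where "g v = (INF t\<in>{0..}. p (v + t *\<^sub>R y) - t * p y)" for v
  have bdd: "bdd_below ((\<lambda>t. p (v + t *\<^sub>R y) - t * p y) ` {0..})" for v
  proof (rule bdd_belowI2[where m = "- p (- v)"])
    fix t :: real assume "t \<in> {0..}"
    then have "t * p y = p (t *\<^sub>R y)" using sublinear_scale[OF p] by simp
    also have "\<dots> \<le> p (v + t *\<^sub>R y) + p (- v)"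
      using sublinear_add[OF p, of "v + t *\<^sub>R y" "- v"] by simp
    finally show "- p (- v) \<le> p (v + t *\<^sub>R y) - t * p y" by simp
  qed
  have low: "g v \<le> p (v + t *\<^sub>R y) - t * p y" if "0 \<le> t" for t v
    unfolding g_def using bdd that by (intro cINF_lower) auto
  have great: "a \<le> g v" if "\<And>t. 0 \<le> t \<Longrightarrow> a \<le> p (v + t *\<^sub>R y) - t * p y" for a v
    unfolding g_def using that by (intro cINF_greatest) auto
  have "sublinear g"
    unfolding sublinear_def
  proof (intro conjI allI impI)
    fix u v
    \<comment> \<open>Parameters add: \<open>t\<close> for \<open>u\<close> and \<open>s\<close> for
      \<open>v\<close> make \<open>t + s\<close> a competitor for \<open>u + v\<close>.\<close>
    have *: "g (u + v) \<le> (p (u + t *\<^sub>R y) - t * p y) + (p (v + s *\<^sub>R y) - s * p y)"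
      if "0 \<le> t" "0 \<le> s" for s t
      using low[of "t + s" "u + v"] that sublinear_add[OF p, of "u + t *\<^sub>R y" "v + s *\<^sub>R y"]
      by (simp add: algebra_simps)
    have "g (u + v) - g u \<le> g v"
    proof (rule great)
      fix s :: real assume s: "0 \<le> s"
      have "g (u + v) - (p (v + s *\<^sub>R y) - s * p y) \<le> g u"
      proof (rule great)
        fix t :: real assume "0 \<le> t"
        then show "g (u + v) - (p (v + s *\<^sub>R y) - s * p y) \<le> p (u + t *\<^sub>R y) - t * p y"
          using *[of t s] s by simp
      qed
      then show "g (u + v) - g u \<le> p (v + s *\<^sub>R y) - s * p y" by simp
    qed
    then show "g (u + v) \<le> g u + g v" by simp
  next
    fix t :: real and v :: 'a assume t: "0 < t"
    have "g (t *\<^sub>R v) / t \<le> g v"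
    proof (rule great)
      fix s :: real assume s: "0 \<le> s"
      have "g (t *\<^sub>R v) \<le> p (t *\<^sub>R v + (t * s) *\<^sub>R y) - (t * s) * p y"
        using s t by (intro low) simp
      also have "p (t *\<^sub>R v + (t * s) *\<^sub>R y) = t * p (v + s *\<^sub>R y)"
        using sublinear_scale[OF p, of t "v + s *\<^sub>R y"] t by (simp add: scaleR_add_right)
      finally show "g (t *\<^sub>R v) / t \<le> p (v + s *\<^sub>R y) - s * p y"
        using t by (simp add: field_simps)
    qed
    then show "g (t *\<^sub>R v) \<le> t * g v" using t by (simp add: field_simps)
  next
    have "0 \<le> g 0" using sublinear_scale[OF p] by (intro great) simp
    moreover have "g 0 \<le> 0" using low[of 0 0] sublinear_zero[OF p] by simp
    ultimately show "g 0 = 0" by simp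
  qed
  moreover have "g \<le> p" using low[of 0] by (simp add: le_fun_def)
  ultimately have "g = p" by (rule min)
  then show ?thesis using low[of 1 x] by simp
qed

text \<open>Hahn--Banach, by way of the fact that a minimal sublinear functional is linear.\<close>

lemma sublinear_dominates_linear:
  fixes q :: "'a::real_vector \<Rightarrow> real"
  assumes "sublinear q"
  obtains h where "linear h" "\<And>x. h x \<le> q x"
proof -
  obtain p where p: "sublinear p" "p \<le> q" "\<And>p'. sublinear p' \<Longrightarrow> p' \<le> p \<Longrightarrow> p' = p"
    using minimal_sublinear_exists[OF assms] by blast
  have add: "p (x + y) = p x + p y" for x y
    using minimal_sublinear_superadditive[OF p(1,3), of x y] sublinear_add[OF p(1), of x y] by simp
  have neg: "p (- x) = - p x" for x
    using add[of x "- x"] sublinear_zero[OF p(1)] by simp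
  have "p (t *\<^sub>R x) = t *\<^sub>R p x" for t x
  proof (cases "0 \<le> t")
    case True
    then show ?thesis using sublinear_scale[OF p(1)] by simp
  next
    case False
    then have "p ((- t) *\<^sub>R x) = (- t) * p x" using sublinear_scale[OF p(1), of "- t" x] by simp
    then show ?thesis using neg[of "t *\<^sub>R x"] by simp
  qed
  then have "linear p" using add by (intro linearI) auto
  then show thesis using p(2) that by (auto simp: le_fun_def)
qed

section \<open>The Clarke derivative as a finite sublinear functional of the direction\<close>

text \<open>This lemma and its counterpart below trade the upper limit for an inequality between
  increments, with one radius for both the base point and the step. The counterpart requires a
  strict bound, so sums and multiples are formed with slightly enlarged bounds.\<close>

lemma clarke_derivative_le:
  assumes "0 < r" "\<And>y s. dist y x < r \<Longrightarrow> 0 < s \<Longrightarrow> s < r \<Longrightarrow> f (y + s *\<^sub>R v) - f y \<le> a * s"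
  shows "clarke_derivative f x v \<le> ereal a"
  unfolding clarke_derivative_def
proof (rule Limsup_bounded)
  have "eventually (\<lambda>y. dist y x < r) (nhds x)"
    using assms(1) by (auto simp: eventually_nhds_metric)
  moreover have "eventually (\<lambda>s. s \<in> {0<..<r}) (at_right 0)"
    using assms(1) by (rule eventually_at_right_real)
  ultimately have "eventually (\<lambda>z. dist (fst z) x < r \<and> snd z \<in> {0<..<r}) (nhds x \<times>\<^sub>F at_right 0)"
    unfolding eventually_prod_filter by auto
  then show "\<forall>\<^sub>F z in nhds x \<times>\<^sub>F at_right 0.
      (case z of (y, \<mu>) \<Rightarrow> ereal ((f (y + \<mu> *\<^sub>R v) - f y) / \<mu>)) \<le> ereal a"
  proof eventually_elim
    case (elim z)
    then show ?case using assms(2)[of "fst z" "snd z"]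
      by (auto simp: case_prod_beta field_simps)
  qed
qed

lemma clarke_derivative_less:
  assumes "clarke_derivative f x v < ereal a"
  obtains r where "0 < r"
    "\<And>y s. dist y x < r \<Longrightarrow> 0 < s \<Longrightarrow> s < r \<Longrightarrow> f (y + s *\<^sub>R v) - f y \<le> a * s"
proof -
  from assms have "\<forall>\<^sub>F (y, s) in nhds x \<times>\<^sub>F at_right 0. (f (y + s *\<^sub>R v) - f y) / s < a"
    unfolding clarke_derivative_def by (auto dest!: Limsup_lessD simp: case_prod_unfold)
  then obtain P Q where PQ: "eventually P (nhds x)" "eventually Q (at_right 0)"
    "\<And>y s. P y \<Longrightarrow> Q s \<Longrightarrow> (f (y + s *\<^sub>R v) - f y) / s < a"
    by (auto simp: eventually_prod_filter)
  obtain r1 where r1: "0 < r1" "\<And>y. dist y x < r1 \<Longrightarrow> P y"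
    using PQ(1) by (auto simp: eventually_nhds_metric)
  obtain r2 where r2: "0 < r2" "\<And>s. 0 < s \<Longrightarrow> s < r2 \<Longrightarrow> Q s"
    using PQ(2) by (auto simp: eventually_at_right_field)
  show thesis
  proof (rule that[of "min r1 r2"])
    fix y s assume "dist y x < min r1 r2" "0 < s" "s < min r1 r2"
    then have "(f (y + s *\<^sub>R v) - f y) / s < a" using PQ(3) r1 r2 by simp
    then show "f (y + s *\<^sub>R v) - f y \<le> a * s" using \<open>0 < s\<close> by (simp add: field_simps)
  qed (use r1 r2 in auto)
qed

lemma clarke_derivative_zero: "clarke_derivative f x 0 = 0"
proof -
  have "nhds x \<times>\<^sub>F at_right (0::real) \<noteq> bot"
    by (simp add: prod_filter_eq_bot)
  then show ?thesis
    unfolding clarke_derivative_def by (simp add: case_prod_unfold Limsup_const zero_ereal_def)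
qed

text \<open>The increment along \<open>v + w\<close> splits at \<open>y + s v\<close>. Its second
  half is an increment along \<open>w\<close> from a moved base point, admissible because base
  points range over a full neighbourhood of \<open>x\<close>.\<close>

lemma clarke_derivative_add_le:
  assumes "clarke_derivative f x v < ereal a" "clarke_derivative f x w < ereal b"
  shows "clarke_derivative f x (v + w) \<le> ereal (a + b)"
proof -
  obtain r where r: "0 < r"
    "\<And>y s. dist y x < r \<Longrightarrow> 0 < s \<Longrightarrow> s < r \<Longrightarrow> f (y + s *\<^sub>R v) - f y \<le> a * s"
    using clarke_derivative_less[OF assms(1)] by blast
  obtain r' where r': "0 < r'"
    "\<And>y s. dist y x < r' \<Longrightarrow> 0 < s \<Longrightarrow> s < r' \<Longrightarrow> f (y + s *\<^sub>R w) - f y \<le> b * s"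
    using clarke_derivative_less[OF assms(2)] by blast
  \<comment> \<open>Dividing by \<open>1 + norm v\<close>, which is positive even for
    \<open>v = 0\<close>, makes both \<open>d\<close> and \<open>d * norm v\<close> at most
    \<open>r' / 2\<close>, so the moved base point stays within \<open>r'\<close> of
    \<open>x\<close>.\<close>
  define d where "d = min (min r r') (r' / 2) / (1 + norm v)"
  have n: "1 + norm v > 0" using norm_ge_zero[of v] by linarith
  have d: "0 < d" using r r' n by (auto simp: d_def)
  have dd: "d * (1 + norm v) = min (min r r') (r' / 2)" using n by (simp add: d_def)
  have "d \<le> d * (1 + norm v)" using d by simp
  then have d1: "d \<le> r" "d \<le> r'" "d \<le> r' / 2" using dd by auto
  have "d * norm v < d * (1 + norm v)" using d by simp
  then have d2: "d * norm v \<le> r' / 2" using dd by auto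
  show ?thesis
  proof (rule clarke_derivative_le[OF d])
    fix y s assume ys: "dist y x < d" "0 < s" "s < d"
    have "dist (y + s *\<^sub>R v) x \<le> dist y x + s * norm v"
      using norm_triangle_ineq[of "y - x" "s *\<^sub>R v"] ys by (simp add: dist_norm algebra_simps)
    also have "s * norm v \<le> d * norm v" using ys by (intro mult_right_mono) auto
    finally have "dist (y + s *\<^sub>R v) x < r'" using ys d1 d2 by linarith
    then have "f (y + s *\<^sub>R v + s *\<^sub>R w) - f (y + s *\<^sub>R v) \<le> b * s"
      using ys d1 by (intro r') auto
    moreover have "f (y + s *\<^sub>R v) - f y \<le> a * s" using ys d1 by (intro r) auto
    ultimately show "f (y + s *\<^sub>R (v + w)) - f y \<le> (a + b) * s"
      by (simp add: algebra_simps)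
  qed
qed

text \<open>A step \<open>s\<close> along \<open>t v\<close> is a step \<open>s * t\<close> along
  \<open>v\<close>; hence the second radius \<open>r / t\<close>.\<close>

lemma clarke_derivative_scale_le:
  assumes "clarke_derivative f x v < ereal a" "0 < t"
  shows "clarke_derivative f x (t *\<^sub>R v) \<le> ereal (t * a)"
proof -
  obtain r where r: "0 < r"
    "\<And>y s. dist y x < r \<Longrightarrow> 0 < s \<Longrightarrow> s < r \<Longrightarrow> f (y + s *\<^sub>R v) - f y \<le> a * s"
    using clarke_derivative_less[OF assms(1)] by blast
  show ?thesis
  proof (rule clarke_derivative_le[of "min r (r / t)"])
    fix y s assume ys: "dist y x < min r (r / t)" "0 < s" "s < min r (r / t)"
    then have "f (y + (s * t) *\<^sub>R v) - f y \<le> a * (s * t)"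
      using assms(2) by (intro r) (auto simp: field_simps)
    then show "f (y + s *\<^sub>R t *\<^sub>R v) - f y \<le> t * a * s" by (simp add: mult_ac)
  qed (use r assms in auto)
qed

lemma locally_lipschitz_clarke_bound:
  assumes "locally_lipschitz f"
  obtains k where "0 < k" "\<And>v. clarke_derivative f x v \<le> ereal (k * norm v)"
proof -
  obtain V k where V: "open V" "x \<in> V" "k > 0"
    "\<And>y z. y \<in> V \<Longrightarrow> z \<in> V \<Longrightarrow> \<bar>f y - f z\<bar> \<le> k * norm (y - z)"
    using assms unfolding locally_lipschitz_def by metis
  obtain e where e: "0 < e" "\<And>y. dist y x < e \<Longrightarrow> y \<in> V"
    using V(1,2) by (auto simp: open_dist)
  show thesis
  proof (rule that[OF V(3)])
    fix v :: 'a
    have n: "1 + norm v > 0" using norm_ge_zero[of v] by linarith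
    define d where "d = e / (1 + norm v)"
    have d: "0 < d" using e n by (simp add: d_def)
    have dd: "d * (1 + norm v) = e" using n by (simp add: d_def)
    show "clarke_derivative f x v \<le> ereal (k * norm v)"
    proof (rule clarke_derivative_le[OF d])
      fix y s assume ys: "dist y x < d" "0 < s" "s < d"
      have "dist (y + s *\<^sub>R v) x \<le> dist y x + s * norm v"
        using norm_triangle_ineq[of "y - x" "s *\<^sub>R v"] ys by (simp add: dist_norm algebra_simps)
      also have "s * norm v \<le> d * norm v" using ys by (intro mult_right_mono) auto
      finally have 1: "dist (y + s *\<^sub>R v) x < e" using ys dd by (simp add: algebra_simps)
      have "d \<le> d * (1 + norm v)" using d by simp
      then have "dist y x < e" using ys dd by linarith
      then have "\<bar>f (y + s *\<^sub>R v) - f y\<bar> \<le> k * norm (s *\<^sub>R v)"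
        using V(4)[OF e(2)[OF 1] e(2), of y] by simp
      then show "f (y + s *\<^sub>R v) - f y \<le> k * norm v * s" using ys by (simp add: mult_ac)
    qed
  qed
qed

text \<open>The Lipschitz bound excludes \<infinity>. It also excludes - \<infinity>: a value -
  \<infinity> at \<open>v\<close> and a finite bound at \<open>- v\<close> would make the value at 0
  negative.\<close>

lemma clarke_derivative_sublinear:
  assumes "locally_lipschitz f"
  obtains g where "sublinear g" "\<And>v. clarke_derivative f x v = ereal (g v)"
proof -
  obtain k where k: "0 < k" "\<And>v. clarke_derivative f x v \<le> ereal (k * norm v)"
    using locally_lipschitz_clarke_bound[OF assms, of x] by blast
  let ?F = "clarke_derivative f x"
  have "?F v \<noteq> - \<infinity>" for v
  proof
    assume "?F v = - \<infinity>"
    \<comment> \<open>The bound here and the one for \<open>- v\<close> add up to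
      \<open>- 1\<close>, whereas the derivative at \<open>v + (- v)\<close> is 0.\<close>
    then have "?F v < ereal (- k * norm v - 2)" by simp
    moreover have "?F (- v) < ereal (k * norm v + 1)"
      using k(2)[of "- v"] by (rule le_less_trans) simp
    ultimately show False
      using clarke_derivative_add_le[of f x v _ "- v"] clarke_derivative_zero[of f x]
      by fastforce
  qed
  moreover have "?F v \<noteq> \<infinity>" for v using k(2)[of v] by auto
  ultimately have fin: "\<exists>r. ?F v = ereal r" for v by (cases "?F v") auto
  then obtain g where g: "\<And>v. ?F v = ereal (g v)" by metis
  have "sublinear g"
    unfolding sublinear_def
  proof (intro conjI allI impI)
    fix v w
    show "g (v + w) \<le> g v + g w"
    proof (rule field_le_epsilon)
      fix e :: real assume "0 < e"
      then show "g (v + w) \<le> g v + g w + e"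
        using clarke_derivative_add_le[of f x v "g v + e / 2" w "g w + e / 2"] by (simp add: g)
    qed
  next
    fix t :: real and v assume t: "0 < t"
    show "g (t *\<^sub>R v) \<le> t * g v"
    proof (rule field_le_epsilon)
      fix e :: real assume "0 < e"
      then show "g (t *\<^sub>R v) \<le> t * g v + e"
        using clarke_derivative_scale_le[of f x v "g v + e / t" t] t by (simp add: g distrib_left)
    qed
  next
    show "g 0 = 0" using clarke_derivative_zero[of f x] by (simp add: g)
  qed
  then show thesis using g that by blast
qed

section \<open>The minimal norm in the Clarke gradient\<close>

text \<open>
  The infimal convolution of \<open>g\<close> and \<open>r * norm\<close> is sublinear, and finite exactly because
  \<open>g v \<ge> - r * norm v\<close>; a linear functional below it is below both.
\<close>

lemma sublinear_dominates_bounded_linear: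
  fixes g :: "'a::real_normed_vector \<Rightarrow> real"
  assumes g: "sublinear g" and r: "0 \<le> r" "\<And>v. - r * norm v \<le> g v"
  obtains \<xi> :: "'a \<Rightarrow>\<^sub>L real" where "\<And>v. \<xi> v \<le> g v" "norm \<xi> \<le> r"
proof -
  define q where "q v = (INF w. g w + r * norm (v - w))" for v
  have *: "- r * norm v \<le> g w + r * norm (v - w)" for v w
  proof -
    have "r * norm w \<le> r * (norm v + norm (v - w))"
      using r(1) norm_triangle_sub[of w v] by (intro mult_left_mono) (auto simp: norm_minus_commute)
    then show ?thesis using r(2)[of w] by (simp add: algebra_simps)
  qed
  have low: "q v \<le> g w + r * norm (v - w)" for v w
    unfolding q_def using * by (intro cINF_lower bdd_belowI2[where m = "- r * norm v"]) auto
  have great: "a \<le> q v" if "\<And>w. a \<le> g w + r * norm (v - w)" for a v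
    unfolding q_def using that by (intro cINF_greatest) auto
  have "sublinear q"
    unfolding sublinear_def
  proof (intro conjI allI impI)
    fix u v
    have **: "q (u + v) \<le> (g w + r * norm (u - w)) + (g z + r * norm (v - z))" for w z
    proof -
      have "norm (u + v - (w + z)) \<le> norm (u - w) + norm (v - z)"
        by (metis add_diff_add norm_triangle_ineq)
      from mult_left_mono[OF this r(1)] show ?thesis
        using low[of "u + v" "w + z"] sublinear_add[OF g, of w z] by (simp add: algebra_simps)
    qed
    have "q (u + v) - q u \<le> q v"
    proof (rule great)
      fix z
      have "q (u + v) - (g z + r * norm (v - z)) \<le> q u"
        using ** by (intro great) (simp add: algebra_simps)
      then show "q (u + v) - q u \<le> g z + r * norm (v - z)" by simp
    qed
    then show "q (u + v) \<le> q u + q v" by simp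
  next
    fix t :: real and v :: 'a assume t: "0 < t"
    have "q (t *\<^sub>R v) / t \<le> q v"
    proof (rule great)
      fix w
      have "q (t *\<^sub>R v) \<le> g (t *\<^sub>R w) + r * norm (t *\<^sub>R (v - w))"
        using low[of "t *\<^sub>R v" "t *\<^sub>R w"] by (simp add: scaleR_diff_right)
      also have "\<dots> = t * (g w + r * norm (v - w))"
        using sublinear_scale[OF g] t by (simp add: distrib_left mult.left_commute)
      finally show "q (t *\<^sub>R v) / t \<le> g w + r * norm (v - w)" using t by (simp add: field_simps)
    qed
    then show "q (t *\<^sub>R v) \<le> t * q v" using t by (simp add: field_simps)
  next
    have "0 \<le> q 0" using *[of 0] by (intro great) simp
    then show "q 0 = 0" using low[of 0 0] sublinear_zero[OF g] by simp
  qed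
  then obtain h where h: "linear h" "\<And>v. h v \<le> q v" using sublinear_dominates_linear by blast
  have hg: "h v \<le> g v" for v using h(2)[of v] low[of v v] by simp
  have hr: "h v \<le> r * norm v" for v using h(2)[of v] low[of v 0] sublinear_zero[OF g] by simp
  have ha: "\<bar>h v\<bar> \<le> r * norm v" for v
    using hr[of v] hr[of "- v"] linear_neg[OF h(1), of v] by simp
  have bl: "bounded_linear h"
    using h(1) ha by (intro bounded_linear_intro[where K = r]) (auto simp: linear_add linear_scale mult.commute)
  show thesis
  proof (rule that[of "Blinfun h"])
    show "Blinfun h v \<le> g v" for v using hg by (simp add: bounded_linear_Blinfun_apply[OF bl])
    show "norm (Blinfun h) \<le> r"
      using ha r(1) by (intro norm_blinfun_bound) (auto simp: bounded_linear_Blinfun_apply[OF bl])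
  qed
qed

text \<open>The set \<open>A\<close> of slopes \<open>s\<close> with
  \<open>- s * norm v \<le> g v\<close> contains \<open>r\<close> and the norm of every gradient
  element. Its infimum \<open>m\<close> is again such a slope, so some gradient element has norm at
  most \<open>m\<close>. The minimum is therefore attained and equals \<open>m\<close>.\<close>

lemma min_norm_gradient_le:
  assumes f: "locally_lipschitz f" and r: "0 \<le> r"
    and lower: "\<And>v. ereal (- r * norm v) \<le> clarke_derivative f x v"
  shows "0 \<le> min_norm_gradient f x" "min_norm_gradient f x \<le> r"
proof -
  obtain g where g: "sublinear g" "\<And>v. clarke_derivative f x v = ereal (g v)"
    using clarke_derivative_sublinear[OF f, of x] by blast
  define A where "A = {s. 0 \<le> s \<and> (\<forall>v. - s * norm v \<le> g v)}"
  have rA: "r \<in> A" using r lower by (auto simp: A_def g)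
  have bA: "bdd_below A" by (rule bdd_belowI[of _ 0]) (auto simp: A_def)
  define m where "m = Inf A"
  have m0: "0 \<le> m" unfolding m_def using rA by (intro cInf_greatest) (auto simp: A_def)
  have "- m * norm v \<le> g v" for v
  proof (cases "v = 0")
    case True
    then show ?thesis using sublinear_zero[OF g(1)] by simp
  next
    case False
    then have nv: "norm v > 0" by simp
    have "- g v / norm v \<le> m"
      unfolding m_def
    proof (rule cInf_greatest)
      fix s assume "s \<in> A"
      then have "- s * norm v \<le> g v" by (simp add: A_def)
      then show "- g v / norm v \<le> s" using nv by (simp add: field_simps)
    qed (use rA in auto)
    then show ?thesis using nv by (simp add: field_simps)
  qed
  then obtain \<xi> :: "'a \<Rightarrow>\<^sub>L real" where \<xi>: "\<And>v. \<xi> v \<le> g v" "norm \<xi> \<le> m"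
    using sublinear_dominates_bounded_linear[OF g(1) m0] by blast
  have ge: "m \<le> norm \<zeta>" if "\<zeta> \<in> clarke_gradient f x" for \<zeta>
  proof -
    have "- norm \<zeta> * norm v \<le> g v" for v
    proof -
      have "\<zeta> v \<le> g v" using that by (auto simp: clarke_gradient_def g)
      moreover have "\<bar>\<zeta> v\<bar> \<le> norm \<zeta> * norm v" using norm_blinfun[of \<zeta> v] by simp
      ultimately show ?thesis by linarith
    qed
    then have "norm \<zeta> \<in> A" by (auto simp: A_def)
    then show ?thesis unfolding m_def using bA by (rule cInf_lower)
  qed
  have \<xi>C: "\<xi> \<in> clarke_gradient f x" using \<xi> by (simp add: clarke_gradient_def g)
  then have "norm \<xi> = m" using ge \<xi>(2) by force
  then have "min_norm_gradient f x = m"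
    unfolding min_norm_gradient_def using \<xi>C ge by (intro Least_equality) auto
  moreover have "m \<le> r" unfolding m_def using rA bA by (rule cInf_lower)
  ultimately show "0 \<le> min_norm_gradient f x" "min_norm_gradient f x \<le> r" using m0 by auto
qed

section \<open>Partitions of unity and continuous extension from compact sets\<close>

text \<open>Tent functions on finitely many balls are normalised by their sum. The weights live on
  the whole space: they sum to 1 on \<open>T\<close> and vanish away from the balls, so a field
  blended with them fades out.\<close>

lemma compact_partition_of_unity:
  fixes T :: "'k::metric_space set"
  assumes "compact T" and \<delta>: "\<And>t. t \<in> T \<Longrightarrow> 0 < \<delta> t"
  obtains I \<psi> where "finite I" "I \<subseteq> T"
    "\<And>i. continuous_on UNIV (\<psi> i :: 'k \<Rightarrow> real)" "\<And>i t. 0 \<le> \<psi> i t"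
    "\<And>i t. 0 < \<psi> i t \<Longrightarrow> dist t i < \<delta> i"
    "\<And>t. (\<Sum>i\<in>I. \<psi> i t) \<le> 1" "\<And>t. t \<in> T \<Longrightarrow> (\<Sum>i\<in>I. \<psi> i t) = 1"
proof -
  have "T \<subseteq> (\<Union>t\<in>T. ball t (\<delta> t))" using \<delta> by force
  then obtain I where I: "I \<subseteq> T" "finite I" "T \<subseteq> (\<Union>t\<in>I. ball t (\<delta> t))"
    using compactE_image[OF assms(1), of T "\<lambda>t. ball t (\<delta> t)"] by blast
  define \<phi> where "\<phi> i t = max 0 (\<delta> i - dist t i)" for i t
  define \<sigma> where "\<sigma> t = (\<Sum>i\<in>I. \<phi> i t)" for t
  have c\<phi>: "continuous_on UNIV (\<phi> i)" for i
    unfolding \<phi>_def by (intro continuous_intros)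
  have c\<sigma>: "continuous_on UNIV \<sigma>"
    unfolding \<sigma>_def by (intro continuous_intros c\<phi>)
  have \<phi>0: "0 \<le> \<phi> i t" for i t by (simp add: \<phi>_def)
  have "0 < \<sigma> t" if t: "t \<in> T" for t
  proof -
    obtain i where i: "i \<in> I" "dist i t < \<delta> i" using I(3) t by (auto simp: mem_ball)
    then have "0 < \<phi> i t" by (simp add: \<phi>_def dist_commute)
    then show ?thesis unfolding \<sigma>_def using i I(2) \<phi>0 by (intro sum_pos2) auto
  qed
  moreover have "\<exists>t\<in>T. \<forall>s\<in>T. \<sigma> t \<le> \<sigma> s" if "T \<noteq> {}"
    using continuous_attains_inf[OF assms(1) that] c\<sigma> continuous_on_subset by blast
  ultimately obtain m where m: "0 < m" "\<And>t. t \<in> T \<Longrightarrow> m \<le> \<sigma> t"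
    by (cases "T = {}") (auto intro: that[of 1])
  \<comment> \<open>Cutting the denominator off at \<open>m\<close>, a positive lower bound of
    \<sigma> on \<open>T\<close>, leaves it unchanged on \<open>T\<close> and prevents division by
    zero elsewhere.\<close>
  define \<psi> where "\<psi> i t = \<phi> i t / max m (\<sigma> t)" for i t
  have sum: "(\<Sum>i\<in>I. \<psi> i t) = \<sigma> t / max m (\<sigma> t)" for t
    by (simp add: \<psi>_def \<sigma>_def sum_divide_distrib)
  show thesis
  proof (rule that[OF I(2,1)])
    show "continuous_on UNIV (\<psi> i)" for i
      unfolding \<psi>_def using m(1) by (intro continuous_intros c\<phi> c\<sigma>) (auto simp: max_def)
    show "0 \<le> \<psi> i t" for i t using m(1) \<phi>0 by (simp add: \<psi>_def le_max_iff_disj)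
    show "dist t i < \<delta> i" if "0 < \<psi> i t" for i t
      using that by (auto simp: \<psi>_def \<phi>_def zero_less_divide_iff max_def split: if_splits)
    show "(\<Sum>i\<in>I. \<psi> i t) \<le> 1" for t using m(1) by (simp add: sum divide_le_eq less_max_iff_disj)
    show "(\<Sum>i\<in>I. \<psi> i t) = 1" if "t \<in> T" for t
      using m(1) m(2)[OF that] by (simp add: sum max_def)
  qed
qed

text \<open>The bound on \<open>u i\<close> is required only where the weight is positive, since in
  the approximation below it is known only for centres near the point considered.\<close>

lemma norm_convex_sum_le:
  fixes u :: "'i \<Rightarrow> 'a::real_normed_vector"
  assumes "\<And>i. i \<in> I \<Longrightarrow> 0 \<le> a i" "\<And>i. i \<in> I \<Longrightarrow> 0 < a i \<Longrightarrow> norm (u i) \<le> b"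
  shows "norm (\<Sum>i\<in>I. a i *\<^sub>R u i) \<le> (\<Sum>i\<in>I. a i) * b"
  unfolding sum_distrib_right
proof (rule sum_norm_le)
  fix i assume "i \<in> I"
  then show "norm (a i *\<^sub>R u i) \<le> a i * b"
    using assms[of i] by (cases "a i = 0") (auto intro: mult_left_mono)
qed

text \<open>Values of \<open>r\<close> at finitely many centres are blended on balls where
  \<open>r\<close> varies by less than \<open>e\<close>. Being a blend with total weight at most 1,
  the result keeps the bound \<open>b\<close> on the whole space, which later gives uniform
  convergence of the series of corrections.\<close>

lemma compact_continuous_approximation:
  fixes r :: "'k::metric_space \<Rightarrow> 'a::real_normed_vector"
  assumes "compact S" "continuous_on S r" "0 \<le> b" "\<And>t. t \<in> S \<Longrightarrow> norm (r t) \<le> b" "0 < e"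
  obtains g where "continuous_on UNIV g" "\<And>t. norm (g t) \<le> b"
    "\<And>t. t \<in> S \<Longrightarrow> norm (r t - g t) \<le> e"
proof -
  have "\<forall>t\<in>S. \<exists>d>0. \<forall>s\<in>S. dist s t < d \<longrightarrow> dist (r s) (r t) < e"
    using assms(2,5) by (simp add: continuous_on_iff)
  then obtain \<delta> where \<delta>: "\<And>t. t \<in> S \<Longrightarrow> 0 < \<delta> t"
    "\<And>t s. t \<in> S \<Longrightarrow> s \<in> S \<Longrightarrow> dist s t < \<delta> t \<Longrightarrow> dist (r s) (r t) < e"
    by metis
  obtain I \<psi> where I: "finite I" "I \<subseteq> S"
    and \<psi>: "\<And>i. continuous_on UNIV (\<psi> i :: 'k \<Rightarrow> real)" "\<And>i t. 0 \<le> \<psi> i t"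
    "\<And>i t. 0 < \<psi> i t \<Longrightarrow> dist t i < \<delta> i"
    "\<And>t. (\<Sum>i\<in>I. \<psi> i t) \<le> 1" "\<And>t. t \<in> S \<Longrightarrow> (\<Sum>i\<in>I. \<psi> i t) = 1"
    using compact_partition_of_unity[OF assms(1), of \<delta>] \<delta>(1) by blast
  show thesis
  proof (rule that[of "\<lambda>t. \<Sum>i\<in>I. \<psi> i t *\<^sub>R r i"])
    show "continuous_on UNIV (\<lambda>t. \<Sum>i\<in>I. \<psi> i t *\<^sub>R r i)"
      by (intro continuous_intros \<psi>(1))
    fix t
    have "norm (\<Sum>i\<in>I. \<psi> i t *\<^sub>R r i) \<le> (\<Sum>i\<in>I. \<psi> i t) * b"
      using I(2) assms(4) \<psi>(2) by (intro norm_convex_sum_le) auto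
    also have "\<dots> \<le> b"
      using mult_right_mono[OF \<psi>(4)[of t] assms(3)] by simp
    finally show "norm (\<Sum>i\<in>I. \<psi> i t *\<^sub>R r i) \<le> b" .
  next
    fix t assume t: "t \<in> S"
    have "r t - (\<Sum>i\<in>I. \<psi> i t *\<^sub>R r i) = (\<Sum>i\<in>I. \<psi> i t *\<^sub>R (r t - r i))"
      using \<psi>(5)[OF t] by (simp add: scaleR_diff_right sum_subtractf flip: scaleR_sum_left)
    also have "norm \<dots> \<le> (\<Sum>i\<in>I. \<psi> i t) * e"
    proof (rule norm_convex_sum_le)
      fix i assume "i \<in> I" "0 < \<psi> i t"
      then show "norm (r t - r i) \<le> e"
        using \<delta>(2)[of i t] \<psi>(3)[of i t] I(2) t by (auto simp: dist_norm)
    qed (use \<psi> in auto)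
    finally show "norm (r t - (\<Sum>i\<in>I. \<psi> i t *\<^sub>R r i)) \<le> e" using \<psi>(5)[OF t] by simp
  qed
qed

text \<open>
  The Dugundji theorem of the library needs an inner product on the codomain. For a compact
  domain, summing successive approximations of the remainders gives an extension with values in
  any Banach space.
\<close>

lemma compact_continuous_extension:
  fixes r :: "'k::metric_space \<Rightarrow> 'a::banach"
  assumes "compact S" "continuous_on S r"
  obtains g where "continuous_on UNIV g" "\<And>t. t \<in> S \<Longrightarrow> g t = r t"
proof -
  have "bounded (r ` S)" using assms compact_continuous_image compact_imp_bounded by blast
  then obtain b where b: "0 < b" "\<And>t. t \<in> S \<Longrightarrow> norm (r t) \<le> b"
    by (auto simp: bounded_pos)
  \<comment> \<open>Remainders are controlled only on \<open>S\<close>, increments everywhere. The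
    clause for \<open>n = 0\<close> pins the first approximation to zero, so that the increments sum
    to \<open>h n\<close>.\<close>
  have "\<exists>h. \<forall>n. (continuous_on UNIV (h n) \<and> (\<forall>t\<in>S. norm (r t - h n t) \<le> b * (1 / 2) ^ n)
      \<and> (n = 0 \<longrightarrow> h n = (\<lambda>_. 0)))
      \<and> (\<forall>t. norm (h (Suc n) t - h n t) \<le> b * (1 / 2) ^ n)"
  proof (rule dependent_nat_choice)
    show "\<exists>h. continuous_on UNIV h \<and> (\<forall>t\<in>S. norm (r t - h t) \<le> b * (1 / 2) ^ 0)
      \<and> (0 = (0::nat) \<longrightarrow> h = (\<lambda>_. 0))"
      using b by (intro exI[of _ "\<lambda>_. 0"]) auto
  next
    fix h :: "'k \<Rightarrow> 'a" and n :: nat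
    assume h: "continuous_on UNIV h \<and> (\<forall>t\<in>S. norm (r t - h t) \<le> b * (1 / 2) ^ n)
      \<and> (n = 0 \<longrightarrow> h = (\<lambda>_. 0))"
    have "continuous_on S (\<lambda>t. r t - h t)"
      using h assms(2) by (intro continuous_intros) (auto intro: continuous_on_subset)
    then obtain g where "continuous_on UNIV g" "\<And>t. norm (g t) \<le> b * (1 / 2) ^ n"
      "\<And>t. t \<in> S \<Longrightarrow> norm (r t - h t - g t) \<le> b * (1 / 2) ^ Suc n"
      using compact_continuous_approximation[OF assms(1),
        of "\<lambda>t. r t - h t" "b * (1 / 2) ^ n" "b * (1 / 2) ^ Suc n"] h b by auto
    then show "\<exists>h'. (continuous_on UNIV h' \<and> (\<forall>t\<in>S. norm (r t - h' t) \<le> b * (1 / 2) ^ Suc n)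
      \<and> (Suc n = 0 \<longrightarrow> h' = (\<lambda>_. 0))) \<and> (\<forall>t. norm (h' t - h t) \<le> b * (1 / 2) ^ n)"
      using h by (intro exI[of _ "\<lambda>t. h t + g t"]) (auto intro!: continuous_intros simp: diff_diff_eq)
  qed
  then obtain h where h: "\<And>n. continuous_on UNIV (h n)" "h 0 = (\<lambda>_. 0)"
    "\<And>n t. t \<in> S \<Longrightarrow> norm (r t - h n t) \<le> b * (1 / 2) ^ n"
    "\<And>n t. norm (h (Suc n) t - h n t) \<le> b * (1 / 2) ^ n"
    by metis
  define g where "g t = (\<Sum>n. h (Suc n) t - h n t)" for t
  have "uniform_limit UNIV (\<lambda>n t. \<Sum>i<n. h (Suc i) t - h i t) g sequentially"
    unfolding g_def using h(4)
    by (intro Weierstrass_m_test[where M = "\<lambda>n. b * (1 / 2) ^ n"] summable_mult summable_geometric) auto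
  moreover have "(\<Sum>i<n. h (Suc i) t - h i t) = h n t" for n t
    by (simp only: sum_lessThan_telescope[of "\<lambda>i. h i t" n] h(2) diff_zero)
  ultimately have lim: "uniform_limit UNIV h g sequentially" by (simp only:)
  show thesis
  proof (rule that)
    show "continuous_on UNIV g"
      using h(1) lim by (intro uniform_limit_theorem) auto
    fix t assume t: "t \<in> S"
    have "(\<lambda>n. b * (1 / 2) ^ n) \<longlonglongrightarrow> b * 0"
      by (intro tendsto_intros LIMSEQ_power_zero) auto
    then have "(\<lambda>n. r t - h n t) \<longlonglongrightarrow> 0"
      using h(3)[OF t] Lim_null_comparison[of "\<lambda>n. r t - h n t" "\<lambda>n. b * (1 / 2) ^ n"] by simp
    moreover have "(\<lambda>n. r t - h n t) \<longlonglongrightarrow> r t - g t"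
      using tendsto_uniform_limitI[OF lim, of t] by (intro tendsto_intros) auto
    ultimately show "g t = r t" using LIMSEQ_unique by fastforce
  qed
qed

section \<open>Attained maxima and Ekeland's variational principle\<close>

text \<open>Attainment gives \<open>GREATEST\<close> its meaning; from here on \<open>max_on\<close>
  is handled only through these two facts.\<close>

lemma max_on_attained:
  assumes "compact S" "S \<noteq> {}" "continuous_on S g"
  shows "\<exists>t\<in>S. max_on S g = g t" "\<And>s. s \<in> S \<Longrightarrow> g s \<le> max_on S g"
proof -
  obtain t where t: "t \<in> S" "\<And>s. s \<in> S \<Longrightarrow> g s \<le> g t"
    using continuous_attains_sup[OF assms] by blast
  then have "max_on S g = g t"
    unfolding max_on_def by (intro Greatest_equality) auto
  then show "\<exists>t\<in>S. max_on S g = g t" "\<And>s. s \<in> S \<Longrightarrow> g s \<le> max_on S g" using t by auto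
qed

text \<open>
  Ekeland's principle for functions on \<open>K\<close> with the sup distance, in a form that does not
  mention that distance.
\<close>

lemma ekeland_uniform:
  fixes M :: "('k \<Rightarrow> 'a::complete_space) set" and \<Phi> :: "('k \<Rightarrow> 'a) \<Rightarrow> real"
  assumes closed: "\<And>P p. (\<And>n. P n \<in> M) \<Longrightarrow> uniform_limit K P p sequentially \<Longrightarrow> p \<in> M"
    and lsc: "\<And>P p b. (\<And>n. P n \<in> M) \<Longrightarrow> uniform_limit K P p sequentially \<Longrightarrow>
      (\<And>n. \<Phi> (P n) \<le> b) \<Longrightarrow> \<Phi> p \<le> b"
    and bdd: "\<And>p. p \<in> M \<Longrightarrow> B \<le> \<Phi> p"
    and e: "0 < e" and K: "K \<noteq> {}" and p0: "p0 \<in> M"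
  obtains p where "p \<in> M" "\<Phi> p \<le> \<Phi> p0"
    "\<And>q. q \<in> M \<Longrightarrow> (\<And>t. t \<in> K \<Longrightarrow> e * dist (p t) (q t) \<le> \<Phi> p - \<Phi> q) \<Longrightarrow> \<Phi> p \<le> \<Phi> q"
proof -
  \<comment> \<open>\<open>S p\<close> is the set of points below \<open>p\<close> in Ekeland's
    order, whose transitivity is the triangle inequality.\<close>
  define S where "S p = {q \<in> M. \<forall>t\<in>K. e * dist (p t) (q t) \<le> \<Phi> p - \<Phi> q}" for p
  have S_self: "p \<in> S p" if "p \<in> M" for p using that by (simp add: S_def)
  have S_trans: "r \<in> S p" if "q \<in> S p" "r \<in> S q" for p q r
  proof -
    have "e * dist (p t) (r t) \<le> \<Phi> p - \<Phi> r" if "t \<in> K" for t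
    proof -
      have "e * dist (p t) (r t) \<le> e * (dist (p t) (q t) + dist (q t) (r t))"
        using e by (intro mult_left_mono dist_triangle) auto
      moreover have "e * dist (p t) (q t) \<le> \<Phi> p - \<Phi> q" "e * dist (q t) (r t) \<le> \<Phi> q - \<Phi> r"
        using \<open>q \<in> S p\<close> \<open>r \<in> S q\<close> \<open>t \<in> K\<close> by (auto simp: S_def)
      ultimately show ?thesis by (simp add: distrib_left)
    qed
    then show ?thesis using that by (auto simp: S_def)
  qed
  have S_le: "\<Phi> q \<le> \<Phi> p" if "q \<in> S p" for p q
  proof -
    obtain t where t: "t \<in> K" using K by blast
    have "0 \<le> e * dist (p t) (q t)" using e by simp
    also have "\<dots> \<le> \<Phi> p - \<Phi> q" using that t by (simp add: S_def)
    finally show ?thesis by simp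
  qed
  \<comment> \<open>Each step descends at least halfway from \<Phi> at \<open>P n\<close> to its
    infimum on \<open>S (P n)\<close>. Stated for all \<open>r\<close> in \<open>S (P n)\<close>,
    the condition does not mention the infimum and passes directly to the limit.\<close>
  have "\<exists>P. \<forall>n. (P n \<in> M \<and> (n = 0 \<longrightarrow> P n = p0)) \<and>
    (P (Suc n) \<in> S (P n) \<and> (\<forall>r\<in>S (P n). 2 * \<Phi> (P (Suc n)) - \<Phi> (P n) \<le> \<Phi> r))"
  proof (rule dependent_nat_choice)
    show "\<exists>p. p \<in> M \<and> (0 = (0::nat) \<longrightarrow> p = p0)" using p0 by blast
  next
    fix p and n :: nat assume p: "p \<in> M \<and> (n = 0 \<longrightarrow> p = p0)"
    let ?m = "Inf (\<Phi> ` S p)"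
    have bS: "bdd_below (\<Phi> ` S p)" using bdd by (intro bdd_belowI2[where m = B]) (auto simp: S_def)
    have ne: "\<Phi> ` S p \<noteq> {}" using S_self p by blast
    have m: "?m \<le> \<Phi> r" if "r \<in> S p" for r using that bS by (intro cInf_lower) auto
    have "\<exists>q\<in>S p. 2 * \<Phi> q - \<Phi> p \<le> ?m"
    proof (cases "?m < \<Phi> p")
      case True
      then have "?m < (?m + \<Phi> p) / 2" by simp
      then obtain q where "q \<in> S p" "\<Phi> q < (?m + \<Phi> p) / 2" using cInf_lessD[OF ne] by blast
      then show ?thesis by (intro bexI[of _ q]) auto
    next
      case False
      then show ?thesis using S_self p by (intro bexI[of _ p]) auto
    qed
    then obtain q where q: "q \<in> S p" "2 * \<Phi> q - \<Phi> p \<le> ?m" by blast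
    then show "\<exists>q. (q \<in> M \<and> (Suc n = 0 \<longrightarrow> q = p0)) \<and>
        (q \<in> S p \<and> (\<forall>r\<in>S p. 2 * \<Phi> q - \<Phi> p \<le> \<Phi> r))"
      using m by (intro exI[of _ q]) (force simp: S_def)
  qed
  then obtain P where P: "\<And>n. P n \<in> M" "P 0 = p0" "\<And>n. P (Suc n) \<in> S (P n)"
    "\<And>n r. r \<in> S (P n) \<Longrightarrow> 2 * \<Phi> (P (Suc n)) - \<Phi> (P n) \<le> \<Phi> r"
    by metis
  have chain: "P m \<in> S (P n)" if "n \<le> m" for n m
    using that by (induction rule: dec_induct) (use P S_self S_trans in blast)+
  have dec: "decseq (\<lambda>n. \<Phi> (P n))" using chain S_le by (auto simp: decseq_def)
  then obtain L where L: "(\<lambda>n. \<Phi> (P n)) \<longlonglongrightarrow> L" "\<And>n. L \<le> \<Phi> (P n)"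
    using decseq_convergent[of "\<lambda>n. \<Phi> (P n)" B] bdd P(1) by blast
  have near: "e * dist (P n t) (P m t) \<le> \<Phi> (P n) - L" if "n \<le> m" "t \<in> K" for n m t
    using chain[OF that(1)] that(2) L(2)[of m] by (force simp: S_def)
  have "uniformly_Cauchy_on K P"
  proof (rule uniformly_Cauchy_onI')
    fix d :: real assume d: "0 < d"
    then have "L < L + e * d" using e by simp
    then have "eventually (\<lambda>n. \<Phi> (P n) < L + e * d) sequentially"
      using L(1) order_tendstoD(2) by blast
    then obtain N where N: "\<And>n. N \<le> n \<Longrightarrow> \<Phi> (P n) < L + e * d"
      by (auto simp: eventually_sequentially)
    have "dist (P n t) (P m t) < d" if "N \<le> n" "n < m" "t \<in> K" for n m t
    proof -
      have "e * dist (P n t) (P m t) < e * d" using near[of n m t] N[of n] that by simp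
      then show ?thesis using e by simp
    qed
    then show "\<exists>N. \<forall>t\<in>K. \<forall>n\<ge>N. \<forall>m>n. dist (P n t) (P m t) < d" by blast
  qed
  then obtain p where p: "uniform_limit K P p sequentially"
    using Cauchy_uniformly_convergent by (auto simp: uniformly_convergent_on_def)
  have pM: "p \<in> M" using closed[OF P(1) p] .
  \<comment> \<open>Dropping the first \<open>n\<close> terms puts the whole sequence at or below
    the level \<open>\<Phi> (P n)\<close>, as \<open>lsc\<close> demands of every term.\<close>
  have pP: "\<Phi> p \<le> \<Phi> (P n)" for n
  proof (rule lsc[of "\<lambda>k. P (k + n)"])
    show "uniform_limit K (\<lambda>k. P (k + n)) p sequentially"
      using p filterlim_compose[OF _ filterlim_add_const_nat_at_top] by blast
    show "\<Phi> (P (k + n)) \<le> \<Phi> (P n)" for k using dec by (simp add: decseq_def)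
  qed (use P in auto)
  then have pL: "\<Phi> p \<le> L" using L(1) by (intro LIMSEQ_le_const) auto
  have pS: "p \<in> S (P n)" for n
  proof -
    have "e * dist (P n t) (p t) \<le> \<Phi> (P n) - \<Phi> p" if t: "t \<in> K" for t
    proof -
      have "(\<lambda>m. e * dist (P n t) (P m t)) \<longlonglongrightarrow> e * dist (P n t) (p t)"
        using tendsto_uniform_limitI[OF p t] by (intro tendsto_intros)
      then have "e * dist (P n t) (p t) \<le> \<Phi> (P n) - L"
        using near[OF _ t] by (intro LIMSEQ_le_const2) auto
      then show ?thesis using pL by simp
    qed
    then show ?thesis using pM by (simp add: S_def)
  qed
  show thesis
  proof (rule that[OF pM])
    show "\<Phi> p \<le> \<Phi> p0" using pP[of 0] P(2) by simp
    fix q assume "q \<in> M" "\<And>t. t \<in> K \<Longrightarrow> e * dist (p t) (q t) \<le> \<Phi> p - \<Phi> q"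
    then have "q \<in> S p" by (simp add: S_def)
    \<comment> \<open>Since \<open>q\<close> lies in every \<open>S (P n)\<close>, the halfway
      inequalities tend to \<open>2 * L - L \<le> \<Phi> q\<close>.\<close>
    then have "2 * \<Phi> (P (Suc n)) - \<Phi> (P n) \<le> \<Phi> q" for n using P(4) S_trans pS by blast
    moreover have "(\<lambda>n. 2 * \<Phi> (P (Suc n)) - \<Phi> (P n)) \<longlonglongrightarrow> 2 * L - L"
      using L(1) by (intro tendsto_intros LIMSEQ_Suc)
    ultimately have "L \<le> \<Phi> q" using LIMSEQ_le_const2[of _ "2 * L - L" "\<Phi> q"] by auto
    then show "\<Phi> p \<le> \<Phi> q" using pL by simp
  qed
qed

section \<open>Lowering the maximum along a path\<close>

text \<open>The displacements are made one after another. Unit-bounded directions with total weight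
  at most \<mu> keep every intermediate point within \<mu> of \<open>y\<close>, so descent that is
  uniform in the base point applies each time. It is assumed only for positive weights: a direction
  whose centre is far away need not descend near \<open>y\<close>.\<close>

lemma descent_sum:
  fixes f :: "'a::real_normed_vector \<Rightarrow> real"
  assumes "finite J" "\<And>i. i \<in> J \<Longrightarrow> 0 \<le> a i" "\<And>i. i \<in> J \<Longrightarrow> norm (v i) \<le> 1"
    and "sum a J \<le> \<mu>"
    and "\<And>i z s. i \<in> J \<Longrightarrow> 0 < a i \<Longrightarrow> dist z y \<le> \<mu> \<Longrightarrow> 0 < s \<Longrightarrow> s \<le> \<mu> \<Longrightarrow>
      f (z + s *\<^sub>R v i) \<le> f z - e * s"
  shows "f (y + (\<Sum>i\<in>J. a i *\<^sub>R v i)) \<le> f y - e * sum a J"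
  using assms
proof (induction J)
  case empty
  then show ?case by simp
next
  case (insert j J)
  have 1: "sum a J + a j \<le> \<mu>" using insert by (simp add: add.commute)
  have 2: "0 \<le> sum a J" using insert by (intro sum_nonneg) auto
  have aj: "0 \<le> a j" using insert by auto
  have IH: "f (y + (\<Sum>i\<in>J. a i *\<^sub>R v i)) \<le> f y - e * sum a J"
  proof (rule insert.IH)
    show "sum a J \<le> \<mu>" using 1 aj by simp
  qed (blast intro: insert.prems)+
  show ?case
  proof (cases "a j = 0")
    case True
    then show ?thesis using IH insert by simp
  next
    case False
    have "norm (\<Sum>i\<in>J. a i *\<^sub>R v i) \<le> sum a J * 1"
      using insert.prems by (intro norm_convex_sum_le) auto
    then have "f (y + (\<Sum>i\<in>J. a i *\<^sub>R v i) + a j *\<^sub>R v j) \<le> f (y + (\<Sum>i\<in>J. a i *\<^sub>R v i)) - e * a j"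
      using False aj 1 2 by (intro insert.prems(4)) (auto simp: dist_norm)
    then show ?thesis using IH insert by (simp add: algebra_simps)
  qed
qed

text \<open>
  The path is pushed in descent directions near its maximum points; a partition of unity blends
  these directions and vanishes on \<open>Ks\<close>.
\<close>

lemma descent_path:
  fixes f :: "'a::real_normed_vector \<Rightarrow> real" and p :: "'k::metric_space \<Rightarrow> 'a"
  assumes K: "compact K" "K \<noteq> {}" and Ks: "closed Ks"
    and f: "continuous_on UNIV f" and p: "continuous_on K p"
    and m: "m = max_on K (\<lambda>t. f (p t))" and Ks_less: "\<And>t. t \<in> Ks \<Longrightarrow> f (p t) < m"
    and e: "0 < e"
    and desc: "\<And>t. t \<in> K \<Longrightarrow> f (p t) = m \<Longrightarrow> \<exists>v r. norm v \<le> 1 \<and> 0 < r \<and>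
      (\<forall>z s. dist z (p t) < r \<longrightarrow> 0 < s \<longrightarrow> s < r \<longrightarrow> f (z + s *\<^sub>R v) \<le> f z - e * s)"
  obtains q \<mu> where "0 < \<mu>" "continuous_on K q" "\<And>t. t \<in> Ks \<Longrightarrow> q t = p t"
    "\<And>t. t \<in> K \<Longrightarrow> dist (p t) (q t) \<le> \<mu>" "max_on K (\<lambda>t. f (q t)) \<le> m - e / 2 * \<mu>"
proof -
  have cf: "continuous_on K (\<lambda>t. f (q t))" if "continuous_on K q" for q
    using continuous_on_compose2[OF f that] by simp
  have le_m: "f (p t) \<le> m" if "t \<in> K" for t
    using max_on_attained(2)[OF K cf[OF p] that] m by simp
  define T where "T = {t \<in> K. f (p t) = m}"
  have "closed K" using K(1) by (rule compact_imp_closed)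
  then have "closed T"
    unfolding T_def by (intro continuous_closed_preimage_constant cf p)
  then have "compact T" using K(1) by (metis T_def compact_Int_closed Collect_conj_eq inf.absorb_iff2 Collect_mem_eq inf_le1)
  obtain v r where vr: "\<And>t. t \<in> T \<Longrightarrow> norm (v t) \<le> 1" "\<And>t. t \<in> T \<Longrightarrow> 0 < r t"
    "\<And>t z s. t \<in> T \<Longrightarrow> dist z (p t) < r t \<Longrightarrow> 0 < s \<Longrightarrow> s < r t \<Longrightarrow> f (z + s *\<^sub>R v t) \<le> f z - e * s"
    using desc unfolding T_def mem_Collect_eq by metis
  \<comment> \<open>The ball around \<open>t\<close> has to avoid \<open>Ks\<close>, so that
    prescribed values survive, and the path has to stay within half the descent radius there, which
    leaves room for the displacement.\<close>
  have "\<exists>d>0. (\<forall>s\<in>K. dist s t < d \<longrightarrow> dist (p s) (p t) < r t / 2) \<and> (\<forall>s\<in>Ks. d \<le> dist s t)"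
    if t: "t \<in> T" for t
  proof -
    have "t \<in> K" using t by (simp add: T_def)
    then obtain d1 where d1: "0 < d1" "\<And>s. s \<in> K \<Longrightarrow> dist s t < d1 \<Longrightarrow> dist (p s) (p t) < r t / 2"
      using p vr(2)[OF t] unfolding continuous_on_iff by (metis half_gt_zero)
    have "t \<in> - Ks" using t Ks_less by (force simp: T_def)
    then obtain d2 where d2: "0 < d2" "\<And>s. dist s t < d2 \<Longrightarrow> s \<in> - Ks"
      using Ks unfolding closed_def open_dist by metis
    show ?thesis using d1 d2 by (intro exI[of _ "min d1 d2"]) (force simp: not_less)
  qed
  then obtain \<delta> where \<delta>: "\<And>t. t \<in> T \<Longrightarrow> 0 < \<delta> t"
    "\<And>t s. t \<in> T \<Longrightarrow> s \<in> K \<Longrightarrow> dist s t < \<delta> t \<Longrightarrow> dist (p s) (p t) < r t / 2"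
    "\<And>t s. t \<in> T \<Longrightarrow> s \<in> Ks \<Longrightarrow> \<delta> t \<le> dist s t"
    by metis
  obtain I \<psi> where I: "finite I" "I \<subseteq> T"
    and \<psi>: "\<And>i. continuous_on UNIV (\<psi> i :: 'k \<Rightarrow> real)" "\<And>i t. 0 \<le> \<psi> i t"
    "\<And>i t. 0 < \<psi> i t \<Longrightarrow> dist t i < \<delta> i"
    "\<And>t. (\<Sum>i\<in>I. \<psi> i t) \<le> 1" "\<And>t. t \<in> T \<Longrightarrow> (\<Sum>i\<in>I. \<psi> i t) = 1"
    using compact_partition_of_unity[OF \<open>compact T\<close>, of \<delta>] \<delta>(1) by blast
  have c\<psi>: "continuous_on K (\<psi> i)" for i using \<psi>(1) continuous_on_subset by blast
  define \<sigma> where "\<sigma> t = (\<Sum>i\<in>I. \<psi> i t)" for t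
  have c\<sigma>: "continuous_on K \<sigma>" unfolding \<sigma>_def by (intro continuous_intros c\<psi>)
  \<comment> \<open>On \<open>W\<close> the blend may be too weak to lower f enough. But the weights
    sum to 1 on \<open>T\<close>, so \<open>W\<close> misses the maximum points, and by compactness
    f o p stays below \<open>m\<close> there by some \<eta>.\<close>
  define W where "W = K \<inter> \<sigma> -` {..1/2}"
  have "closed W"
    unfolding W_def using c\<sigma> \<open>closed K\<close> by (intro continuous_closed_preimage) auto
  then have "compact W" using K(1) by (metis W_def compact_Int_closed inf.left_idem)
  have WK: "W \<subseteq> K" by (auto simp: W_def)
  have "\<exists>\<eta>>0. \<forall>t\<in>W. f (p t) \<le> m - \<eta>"
  proof (cases "W = {}")
    case True
    then show ?thesis by (intro exI[of _ 1]) auto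
  next
    case False
    obtain w where w: "w \<in> W" "\<And>t. t \<in> W \<Longrightarrow> f (p t) \<le> f (p w)"
      using continuous_attains_sup[OF \<open>compact W\<close> False continuous_on_subset[OF cf[OF p] WK]] by blast
    have "w \<notin> T" using w(1) \<psi>(5)[of w] by (auto simp: W_def \<sigma>_def)
    then have "f (p w) < m" using le_m[of w] w(1) WK by (force simp: T_def)
    then show ?thesis using w(2) by (intro exI[of _ "m - f (p w)"]) auto
  qed
  then obtain \<eta> where \<eta>: "0 < \<eta>" "\<And>t. t \<in> W \<Longrightarrow> f (p t) \<le> m - \<eta>" by blast
  \<comment> \<open>The inserted 1 gives \<open>Min\<close> a nonempty set without a separate
    argument about \<open>I\<close>.\<close>
  define \<rho> where "\<rho> = Min (insert 1 (r ` I))"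
  have \<rho>: "0 < \<rho>" "\<And>i. i \<in> I \<Longrightarrow> \<rho> \<le> r i"
    using I vr(2) by (auto simp: \<rho>_def)
  \<comment> \<open>With \<open>\<rho> / 3\<close>, a point within \<mu> of \<open>p t\<close> is at
    distance at most \<open>r i / 2 + r i / 3 < r i\<close> from \<open>p i\<close>. With
    \<open>\<eta> / e\<close>, the margin \<eta> on \<open>W\<close> covers the required
    gain.\<close>
  define \<mu> where "\<mu> = min (\<rho> / 3) (\<eta> / e)"
  have \<mu>: "0 < \<mu>" "\<mu> \<le> \<rho> / 3" "e * \<mu> \<le> \<eta>"
  proof -
    show "0 < \<mu>" using \<rho> \<eta> e by (auto simp: \<mu>_def)
    show "\<mu> \<le> \<rho> / 3" unfolding \<mu>_def by (rule min.cobounded1)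
    have "\<mu> \<le> \<eta> / e" by (simp add: \<mu>_def)
    then show "e * \<mu> \<le> \<eta>" using e by (simp add: field_simps)
  qed
  define q where "q t = p t + (\<Sum>i\<in>I. (\<mu> * \<psi> i t) *\<^sub>R v i)" for t
  have cq: "continuous_on K q"
    unfolding q_def by (intro continuous_intros c\<psi> p)
  have sum: "(\<Sum>i\<in>I. \<mu> * \<psi> i t) = \<mu> * \<sigma> t" for t by (simp add: \<sigma>_def sum_distrib_left)
  have \<sigma>1: "\<mu> * \<sigma> t \<le> \<mu>" for t using \<mu>(1) \<psi>(4)[of t] by (simp add: \<sigma>_def)
  have \<sigma>0: "0 \<le> \<sigma> t" for t using \<psi>(2) by (simp add: \<sigma>_def sum_nonneg)
  have fq: "f (q t) \<le> f (p t) - e * (\<mu> * \<sigma> t)" if t: "t \<in> K" for t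
    unfolding q_def sum[symmetric]
  proof (rule descent_sum[where \<mu> = \<mu>])
    show "(\<Sum>i\<in>I. \<mu> * \<psi> i t) \<le> \<mu>" using \<sigma>1 by (simp add: sum)
    fix i assume i: "i \<in> I"
    then have iT: "i \<in> T" using I by blast
    show "0 \<le> \<mu> * \<psi> i t" using \<mu>(1) \<psi>(2) by simp
    show "norm (v i) \<le> 1" using vr(1)[OF iT] .
    fix z s assume *: "0 < \<mu> * \<psi> i t" "dist z (p t) \<le> \<mu>" "0 < s" "s \<le> \<mu>"
    have "dist t i < \<delta> i" using * \<mu>(1) \<psi>(3)[of i t] by (simp add: zero_less_mult_iff)
    then have "dist (p t) (p i) < r i / 2" using \<delta>(2)[OF iT t] by simp
    then have "dist z (p i) < r i"
      using *(2) \<mu>(2) \<rho>(1) \<rho>(2)[OF i] dist_triangle[of z "p i" "p t"] by linarith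
    moreover have "s < r i" using *(4) \<mu>(2) \<rho>(1) \<rho>(2)[OF i] by linarith
    ultimately show "f (z + s *\<^sub>R v i) \<le> f z - e * s" using vr(3)[OF iT] *(3) by blast
  qed (use I in auto)
  show thesis
  proof (rule that[OF \<mu>(1) cq])
    fix t assume t: "t \<in> Ks"
    have "\<psi> i t = 0" if "i \<in> I" for i
      using \<psi>(2)[of i t] \<psi>(3)[of i t] \<delta>(3)[of i t] that I(2) t by force
    then show "q t = p t" by (simp add: q_def)
  next
    fix t assume t: "t \<in> K"
    have "norm (\<Sum>i\<in>I. (\<mu> * \<psi> i t) *\<^sub>R v i) \<le> (\<Sum>i\<in>I. \<mu> * \<psi> i t) * 1"
      using \<mu>(1) \<psi>(2) vr(1) I(2) by (intro norm_convex_sum_le) auto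
    then show "dist (p t) (q t) \<le> \<mu>" using \<sigma>1[of t] by (simp add: sum q_def dist_norm)
  next
    obtain t where t: "t \<in> K" "max_on K (\<lambda>t. f (q t)) = f (q t)"
      using max_on_attained(1)[OF K cf[OF cq]] by blast
    have "f (q t) \<le> m - e / 2 * \<mu>"
    proof (cases "t \<in> W")
      case True
      have "0 \<le> e * (\<mu> * \<sigma> t)" using e \<mu>(1) \<sigma>0[of t] by simp
      then have "f (q t) \<le> m - \<eta>" using fq[OF t(1)] \<eta>(2)[OF True] by linarith
      moreover have "e / 2 * \<mu> \<le> e * \<mu>" using e \<mu>(1) by simp
      ultimately show ?thesis using \<mu>(3) by linarith
    next
      case False
      then have "1 / 2 \<le> \<sigma> t" using t(1) by (simp add: W_def)
      then have "e * \<mu> * (1 / 2) \<le> e * \<mu> * \<sigma> t" using e \<mu>(1) by (intro mult_left_mono) auto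
      then show ?thesis using fq[OF t(1)] le_m[OF t(1)] by (simp add: mult_ac)
    qed
    then show "max_on K (\<lambda>t. f (q t)) \<le> m - e / 2 * \<mu>" using t(2) by simp
  qed
qed

section \<open>Small gradient or uniform descent, and the minimax argument\<close>

lemma locally_lipschitz_continuous_on:
  assumes "locally_lipschitz f"
  shows "continuous_on UNIV f"
proof -
  have "isCont f x" for x
  proof -
    obtain V k where V: "open V" "x \<in> V" "k > 0"
      "\<And>y z. y \<in> V \<Longrightarrow> z \<in> V \<Longrightarrow> \<bar>f y - f z\<bar> \<le> k * norm (y - z)"
      using assms unfolding locally_lipschitz_def by metis
    have "k-lipschitz_on V f" using V by (intro lipschitz_onI) (auto simp: dist_norm)
    then have "continuous_on V f" by (rule lipschitz_on_continuous_on)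
    then show ?thesis using V(1,2) by (simp add: continuous_on_eq_continuous_at)
  qed
  then show ?thesis by (simp add: continuous_on_eq_continuous_at)
qed

text \<open>If the slope bound with constant \<open>e\<close> fails at some \<open>v\<close>, then
  \<open>v\<close> is nonzero because the derivative vanishes at 0, and it can be normalised.
  Normalising yields only the non-strict bound \<open>- e\<close>; the margin to
  \<open>- (e / 2)\<close> restores the strictness from which the radius comes.\<close>

lemma min_norm_gradient_small_or_descent:
  assumes f: "locally_lipschitz f" and e: "0 < e"
  obtains (small) "0 \<le> min_norm_gradient f x" "min_norm_gradient f x \<le> e"
    | (descent) v r where "norm v \<le> 1" "0 < r"
      "\<And>z s. dist z x < r \<Longrightarrow> 0 < s \<Longrightarrow> s < r \<Longrightarrow> f (z + s *\<^sub>R v) \<le> f z - e / 2 * s"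
proof (cases "\<forall>v. ereal (- e * norm v) \<le> clarke_derivative f x v")
  case True
  then show ?thesis using small min_norm_gradient_le[OF f, of e x] e by auto
next
  case False
  then obtain v where v: "clarke_derivative f x v < ereal (- e * norm v)" by (auto simp: not_le)
  then have nz: "v \<noteq> 0" using clarke_derivative_zero[of f x] by auto
  then have eq: "inverse (norm v) * (- e * norm v) = - e" by (simp add: field_simps)
  then have "clarke_derivative f x (inverse (norm v) *\<^sub>R v) \<le> ereal (- e)"
    using clarke_derivative_scale_le[OF v, of "inverse (norm v)"] nz unfolding eq by simp
  then have "clarke_derivative f x (inverse (norm v) *\<^sub>R v) < ereal (- (e / 2))"
    by (rule le_less_trans) (use e in simp)
  then obtain r where r: "0 < r" "\<And>z s. dist z x < r \<Longrightarrow> 0 < s \<Longrightarrow> s < r \<Longrightarrow>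
      f (z + s *\<^sub>R inverse (norm v) *\<^sub>R v) - f z \<le> - (e / 2) * s"
    using clarke_derivative_less by blast
  show ?thesis
  proof (rule descent[OF _ r(1)])
    show "norm (inverse (norm v) *\<^sub>R v) \<le> 1" using nz by simp
    show "f (z + s *\<^sub>R inverse (norm v) *\<^sub>R v) \<le> f z - e / 2 * s"
      if "dist z x < r" "0 < s" "s < r" for z s
      using r(2)[OF that] by simp
  qed
qed

text \<open>One accuracy \<open>e\<close> serves both the level and the gradient, so taking
  \<open>e = 1 / (n + 1)\<close> produces the sequence. The lower bound 0 belongs to the claim
  because convergence to 0 requires control from both sides.\<close>

lemma almost_critical_point:
  fixes f :: "'a::banach \<Rightarrow> real" and K Ks :: "'k::metric_space set" and ps :: "'k \<Rightarrow> 'a"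
  assumes f: "locally_lipschitz f" and K: "compact K"
    and Ks: "Ks \<subseteq> K" "Ks \<noteq> {}" "closed Ks" and ps: "continuous_on Ks ps"
    and c: "c = minimax_level f K Ks ps" and c_gt: "c > max_on Ks (\<lambda>t. f (ps t))" and e: "0 < e"
  shows "\<exists>x. \<bar>f x - c\<bar> \<le> e \<and> 0 \<le> min_norm_gradient f x \<and> min_norm_gradient f x \<le> e"
proof (rule ccontr)
  assume contra: "\<not> ?thesis"
  define M where "M = extensions K Ks ps"
  define \<Phi> where "\<Phi> p = max_on K (\<lambda>t. f (p t))" for p :: "'k \<Rightarrow> 'a"
  have Kne: "K \<noteq> {}" using Ks by blast
  have cf: "continuous_on UNIV f" using f by (rule locally_lipschitz_continuous_on)
  have cfp: "continuous_on A (\<lambda>t. f (p t))" if "continuous_on A p" for A and p :: "'k \<Rightarrow> 'a"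
    using continuous_on_compose2[OF cf that] by simp
  have upper: "f (p t) \<le> \<Phi> p" if "p \<in> M" "t \<in> K" for p t
    unfolding \<Phi>_def using that by (intro max_on_attained(2)[OF K Kne] cfp) (auto simp: M_def extensions_def)
  have att: "\<exists>t\<in>K. \<Phi> p = f (p t)" if "p \<in> M" for p
    unfolding \<Phi>_def using that by (intro max_on_attained(1)[OF K Kne] cfp) (auto simp: M_def extensions_def)
  have "compact Ks" using K Ks by (metis compact_Int_closed inf.absorb_iff2)
  then obtain g where "continuous_on UNIV g" "\<And>t. t \<in> Ks \<Longrightarrow> g t = ps t"
    using compact_continuous_extension ps by blast
  then have "g \<in> M" unfolding M_def extensions_def using continuous_on_subset by blast
  then have Mne: "M \<noteq> {}" by blast
  \<comment> \<open>Every admissible path takes the value \<open>ps t0\<close> at \<open>t0\<close>,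
    so \<open>f (ps t0)\<close> bounds all maxima from below and the infimum is genuine.\<close>
  obtain t0 where t0: "t0 \<in> Ks" using Ks by blast
  have bdd: "f (ps t0) \<le> \<Phi> p" if "p \<in> M" for p
    using upper[OF that, of t0] that t0 Ks(1) by (auto simp: M_def extensions_def)
  have c': "c = (INF p\<in>M. \<Phi> p)" unfolding c minimax_level_def M_def \<Phi>_def ..
  have c_le: "c \<le> \<Phi> p" if "p \<in> M" for p
    unfolding c' using that bdd by (intro cINF_lower bdd_belowI2[where m = "f (ps t0)"])
  have "\<exists>p\<in>M. \<Phi> p < c + e"
    using e c' cInf_lessD[of "\<Phi> ` M" "c + e"] Mne by auto
  then obtain p0 where p0: "p0 \<in> M" "\<Phi> p0 < c + e" by blast
  obtain p where p: "p \<in> M" "\<Phi> p \<le> \<Phi> p0"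
    "\<And>q. q \<in> M \<Longrightarrow> (\<And>t. t \<in> K \<Longrightarrow> e / 4 * dist (p t) (q t) \<le> \<Phi> p - \<Phi> q) \<Longrightarrow> \<Phi> p \<le> \<Phi> q"
  proof (rule ekeland_uniform[where M = M and K = K and \<Phi> = \<Phi> and B = "f (ps t0)" and e = "e / 4"])
    \<comment> \<open>Uniform limits keep continuity and the values on \<open>Ks\<close>. For
      semicontinuity it suffices to follow the paths at a single maximum point of the limit.\<close>
    fix P :: "nat \<Rightarrow> 'k \<Rightarrow> 'a" and p
    assume P: "\<And>n. P n \<in> M" and lim: "uniform_limit K P p sequentially"
    have ptw: "(\<lambda>n. P n t) \<longlonglongrightarrow> p t" if "t \<in> K" for t
      using tendsto_uniform_limitI[OF lim that] .
    have "continuous_on K p"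
      using P by (intro uniform_limit_theorem[OF _ lim]) (auto simp: M_def extensions_def)
    moreover have "p t = ps t" if "t \<in> Ks" for t
    proof -
      have "P n t = ps t" for n using P[of n] that by (simp add: M_def extensions_def)
      then have "(\<lambda>_::nat. ps t) \<longlonglongrightarrow> p t" using ptw[of t] that Ks(1) by auto
      then show ?thesis by (simp add: LIMSEQ_const_iff)
    qed
    ultimately show pM: "p \<in> M" by (simp add: M_def extensions_def)
    fix b assume b: "\<And>n. \<Phi> (P n) \<le> b"
    obtain t where t: "t \<in> K" "\<Phi> p = f (p t)" using att[OF pM] by blast
    have "(\<lambda>n. f (P n t)) \<longlonglongrightarrow> f (p t)"
      using continuous_on_tendsto_compose[OF cf ptw[OF t(1)]] by simp
    then show "\<Phi> p \<le> b"
      unfolding t(2) using upper[OF P t(1)] b by (intro LIMSEQ_le_const2) (auto intro: order_trans)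
  qed (use bdd e Kne p0 in auto)
  have cp: "continuous_on K p" using p(1) by (simp add: M_def extensions_def)
  have Ks_less: "f (p t) < \<Phi> p" if "t \<in> Ks" for t
  proof -
    have "f (p t) \<le> max_on Ks (\<lambda>t. f (ps t))"
      using max_on_attained(2)[OF \<open>compact Ks\<close> Ks(2) cfp[OF ps] that] p(1) that
      by (simp add: M_def extensions_def)
    then show ?thesis using c_gt c_le[OF p(1)] by linarith
  qed
  have desc: "\<exists>v r. norm v \<le> 1 \<and> 0 < r \<and>
      (\<forall>z s. dist z (p t) < r \<longrightarrow> 0 < s \<longrightarrow> s < r \<longrightarrow> f (z + s *\<^sub>R v) \<le> f z - e / 2 * s)"
    if "t \<in> K" "f (p t) = \<Phi> p" for t
    using f e
  proof (cases rule: min_norm_gradient_small_or_descent[of f e "p t"])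
    case small
    \<comment> \<open>From \<open>c \<le> \<Phi> p \<le> \<Phi> p0 < c + e\<close>, every maximum
      point lies within \<open>e\<close> of the level, where the negated claim rules out a small
      gradient.\<close>
    moreover have "\<bar>f (p t) - c\<bar> \<le> e" using that(2) c_le[OF p(1)] p(2) p0(2) by simp
    ultimately show ?thesis using contra by blast
  next
    case (descent v r)
    then show ?thesis by blast
  qed
  \<comment> \<open>Descent at rate \<open>e / 2\<close> yields a gain of
    \<open>e / 4 * \<mu>\<close> for a displacement of at most \<mu>, which makes \<open>q\<close> a
    competitor in the variational inequality for \<open>p\<close>.\<close>
  obtain q \<mu> where q: "0 < \<mu>" "continuous_on K q" "\<And>t. t \<in> Ks \<Longrightarrow> q t = p t"
    "\<And>t. t \<in> K \<Longrightarrow> dist (p t) (q t) \<le> \<mu>" "\<Phi> q \<le> \<Phi> p - e / 2 / 2 * \<mu>"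
    unfolding \<Phi>_def
    by (rule descent_path[OF K Kne Ks(3) cf cp refl, of "e / 2"])
       (use Ks_less desc e in \<open>auto simp: \<Phi>_def\<close>)
  have qM: "q \<in> M" using q(2,3) p(1) by (simp add: M_def extensions_def)
  have "\<Phi> p \<le> \<Phi> q"
  proof (rule p(3)[OF qM])
    fix t assume "t \<in> K"
    then have "e / 4 * dist (p t) (q t) \<le> e / 4 * \<mu>" using q(4) e by (intro mult_left_mono) auto
    then show "e / 4 * dist (p t) (q t) \<le> \<Phi> p - \<Phi> q" using q(5) by simp
  qed
  moreover have "0 < e / 2 / 2 * \<mu>" using e q(1) by simp
  ultimately show False using q(5) by linarith
qed

theorem theorem18:
  fixes f :: "'a::banach \<Rightarrow> real"
    and K Ks :: "'k::metric_space set"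
    and ps :: "'k \<Rightarrow> 'a"
    and c :: real
  assumes "locally_lipschitz f"
    and "compact K"
    and "Ks \<subseteq> K" and "Ks \<noteq> {}" and "closed Ks"
    and "continuous_on Ks ps"
    and "c = minimax_level f K Ks ps"
    and "c > max_on Ks (\<lambda>t. f (ps t))"
  shows "\<exists>x :: nat \<Rightarrow> 'a.
           (\<lambda>n. f (x n)) \<longlonglongrightarrow> c \<and>
           (\<lambda>n. min_norm_gradient f (x n)) \<longlonglongrightarrow> 0"
proof -
  have "\<forall>n. \<exists>x. \<bar>f x - c\<bar> \<le> inverse (real (Suc n)) \<and>
      0 \<le> min_norm_gradient f x \<and> min_norm_gradient f x \<le> inverse (real (Suc n))"
    by (intro allI almost_critical_point[OF assms]) simp
  then obtain x where x: "\<And>n. \<bar>f (x n) - c\<bar> \<le> inverse (real (Suc n))"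
    "\<And>n. 0 \<le> min_norm_gradient f (x n)" "\<And>n. min_norm_gradient f (x n) \<le> inverse (real (Suc n))"
    by metis
  have "(\<lambda>n. f (x n) - c) \<longlonglongrightarrow> 0"
    using x(1) by (intro Lim_null_comparison[OF _ LIMSEQ_inverse_real_of_nat] always_eventually) auto
  then have "(\<lambda>n. f (x n)) \<longlonglongrightarrow> c" by (simp add: LIM_zero_iff)
  moreover have "(\<lambda>n. min_norm_gradient f (x n)) \<longlonglongrightarrow> 0"
    using x(2,3) by (intro Lim_null_comparison[OF _ LIMSEQ_inverse_real_of_nat] always_eventually) auto
  ultimately show ?thesis by blast
qed

end
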